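(* Let $\mathcal{D}\subset\mathbb{Z}$ be a finite set, let $B=\max\{|b|: b\in\mathcal{D}\}$, and let $P\in\mathbb{Z}[X]$ be a monic polynomial with no roots on the unit circle $|z|=1$, with factorization $P(X)=(X-\alpha_1)^{e_1}\cdots(X-\alpha_s)^{e_s}$ in $\mathbb{C}[X]$ ($\alpha_i$ distinct, $e_i\ge1$). Let $\mathrm{Rem}(P,B)$ be the set of all $R\in\mathbb{Z}[X]$ with $\deg R<\deg P$ such that $|R^{(k)}(\alpha_j)|\le k!\,B/\big||\alpha_j|-1\big|^{k+1}$ for all $j\in\{1,\dots,s\}$ and $k\in\{0,\dots,e_j-1\}$. Let $\mathcal{G}=\mathcal{G}(P,\mathcal{D})$ be the directed graph whose vertex set is $\mathrm{Rem}(P,B)\cup\mathcal{D}$ (elements of $\mathcal{D}$ viewed as constant polynomials), with a directed edge from $R_i$ to $R_j$ whenever $R_j\equiv X\cdot R_i+b \pmod{P}$ in $\mathbb{Z}[X]$ for some $b\in\mathcal{D}$. Let $a_n\in\mathcal{D}$, $a_n\neq0$. Then $P$ divides a polynomial $Q(X)=a_nX^n+a_{n-1}X^{n-1}+\dots+a_1X+a_0$ of degree $n$ with all coefficients $a_0,\dots,a_n\in\mathcal{D}$ if and only if $\mathcal{G}$ contains a directed path of length $n$ starting at the constant polynomial $a_n$ and ending at the zero polynomial.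
   Context: $R^{(k)}$ denotes the $k$-th derivative of $R$, with $R^{(0)}=R$. Congruence modulo the monic polynomial $P$ means equality of remainders under division by $P$ in $\mathbb{Z}[X]$. *)

theory Defs
  imports
    Complex_Main
    "HOL-Computational_Algebra.Polynomial"
    "Graph_Theory.Arc_Walk"
begin

text \<open>
  The type \<^typ>\<open>int poly\<close> has no \<open>mod\<close>. For monic \<open>P\<close>, however, pseudo-division involves no scaling,
  so \<^const>\<open>pseudo_mod\<close> is the remainder of division by \<open>P\<close> in \<open>\<int>[X]\<close>; this is the lemma below.
\<close>

definition cong_poly :: "int poly \<Rightarrow> int poly \<Rightarrow> int poly \<Rightarrow> bool" where
  "cong_poly P A C \<longleftrightarrow> pseudo_mod A P = pseudo_mod C P"

lemma pseudo_mod_monic_iff: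
  fixes P A R :: "int poly"
  assumes "lead_coeff P = 1"
  shows "pseudo_mod A P = R \<longleftrightarrow> (\<exists>Q. A = P * Q + R) \<and> (R = 0 \<or> degree R < degree P)"
proof
  have P0: "P \<noteq> 0" using assms by auto
  obtain q r where qr: "pseudo_divmod A P = (q, r)" by force
  have r: "r = pseudo_mod A P" using qr by (simp add: pseudo_mod_def)
  have 1: "A = P * q + pseudo_mod A P"
    and 2: "pseudo_mod A P = 0 \<or> degree (pseudo_mod A P) < degree P"
    using pseudo_divmod[OF P0 qr] assms r by auto
  show "(\<exists>Q. A = P * Q + R) \<and> (R = 0 \<or> degree R < degree P)" if "pseudo_mod A P = R"
    using 1 2 that by blast
  assume "(\<exists>Q. A = P * Q + R) \<and> (R = 0 \<or> degree R < degree P)"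
  then obtain Q where Q: "A = P * Q + R" and R: "R = 0 \<or> degree R < degree P" by blast
  show "pseudo_mod A P = R"
  proof (rule ccontr)
    assume ne: "pseudo_mod A P \<noteq> R"
    have eq: "P * (Q - q) = pseudo_mod A P - R"
      using 1 Q by (simp add: algebra_simps)
    with ne have "Q - q \<noteq> 0" by auto
    hence "degree P \<le> degree (pseudo_mod A P - R)"
      unfolding eq[symmetric] using P0 by (simp add: degree_mult_eq)
    moreover have "degree (pseudo_mod A P - R) < degree P"
      using 2 R ne by (auto intro: degree_diff_less)
    ultimately show False by simp
  qed
qed

text \<open>
  The numbers \<open>\<alpha> 1, \<dots>, \<alpha> s\<close> and \<open>e 1, \<dots>, e s\<close> are the distinct complex roots of \<open>P\<close> and their
  multiplicities. The disjunct \<open>R = 0\<close> reflects the convention that the zero polynomial has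
  degree \<open>-\<infinity>\<close>.
\<close>

definition Rem :: "int poly \<Rightarrow> nat \<Rightarrow> (nat \<Rightarrow> complex) \<Rightarrow> (nat \<Rightarrow> nat) \<Rightarrow> int \<Rightarrow> int poly set" where
  "Rem P s \<alpha> e B =
     {R. (R = 0 \<or> degree R < degree P) \<and>
         (\<forall>j\<in>{1..s}. \<forall>k<e j.
            cmod (poly ((pderiv ^^ k) (map_poly complex_of_int R)) (\<alpha> j))
              \<le> fact k * real_of_int B / \<bar>cmod (\<alpha> j) - 1\<bar> ^ (k + 1))}"

definition rem_verts :: "int poly \<Rightarrow> nat \<Rightarrow> (nat \<Rightarrow> complex) \<Rightarrow> (nat \<Rightarrow> nat) \<Rightarrow> int set \<Rightarrow> int poly set" where
  "rem_verts P s \<alpha> e D = Rem P s \<alpha> e (Max (abs ` D)) \<union> (\<lambda>d. [:d:]) ` D"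

definition rem_graph ::
  "int poly \<Rightarrow> nat \<Rightarrow> (nat \<Rightarrow> complex) \<Rightarrow> (nat \<Rightarrow> nat) \<Rightarrow> int set
    \<Rightarrow> (int poly, int poly \<times> int poly) pre_digraph" where
  "rem_graph P s \<alpha> e D =
     \<lparr>verts = rem_verts P s \<alpha> e D,
      arcs = {(R, S). R \<in> rem_verts P s \<alpha> e D \<and> S \<in> rem_verts P s \<alpha> e D \<and>
                      (\<exists>b\<in>D. cong_poly P S ([:0, 1:] * R + [:b:]))},
      tail = fst,
      head = snd\<rparr>"

end

theory Submission
  imports Defs
begin

text \<open>
  Write \<open>Q\<^sub>i\<close> for the quotient of \<open>Q\<close> by \<open>X\<^sup>i\<close>, so that Horner's scheme reads
  \<open>Q\<^sub>i = X Q\<^sub>i\<^sub>+\<^sub>1 + a\<^sub>i\<close> and a walk in the graph is the sequence of the remainders of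
  \<open>Q\<^sub>n, \<dots>, Q\<^sub>0\<close> modulo \<open>P\<close>. Only the bounds on the remainders need an argument. At a root \<open>\<alpha>\<close> the
  derivatives satisfy \<open>Q\<^sub>i\<^sup>(\<^sup>k\<^sup>)(\<alpha>) = \<alpha> Q\<^sub>i\<^sub>+\<^sub>1\<^sup>(\<^sup>k\<^sup>)(\<alpha>) + k Q\<^sub>i\<^sub>+\<^sub>1\<^sup>(\<^sup>k\<^sup>-\<^sup>1\<^sup>)(\<alpha>) + [k = 0] a\<^sub>i\<close>.
  If \<open>|\<alpha>| < 1\<close>, this recursion propagates the bound downwards in \<open>i\<close>, from the constant \<open>Q\<^sub>n\<close>; if
  \<open>|\<alpha>| > 1\<close>, it is solved for \<open>Q\<^sub>i\<^sub>+\<^sub>1\<^sup>(\<^sup>k\<^sup>)(\<alpha>)\<close> and propagates the bound upwards, from \<open>Q\<^sub>0 = Q\<close>,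
  whose derivatives of order below the multiplicity of \<open>\<alpha>\<close> vanish. In both cases the bound
  \<open>k! B / ||\<alpha>| - 1|\<^sup>k\<^sup>+\<^sup>1\<close> is exactly the one that is reproduced.
\<close>

section \<open>Derivatives in Horner's scheme and at multiple roots\<close>

lemma higher_pderiv_Suc_pCons:
  "(pderiv ^^ Suc k) (pCons b p) =
    pCons 0 ((pderiv ^^ Suc k) p) + smult (of_nat (Suc k)) ((pderiv ^^ k) p)"
  by (induction k) (simp_all add: pderiv_add pderiv_pCons pderiv_smult smult_add_left add_ac)

lemma poly_higher_pderiv_Suc_pCons:
  fixes a :: "'a::{idom,semiring_char_0}"
  shows "poly ((pderiv ^^ Suc k) (pCons b p)) a =
    a * poly ((pderiv ^^ Suc k) p) a + of_nat (Suc k) * poly ((pderiv ^^ k) p) a"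
  by (subst higher_pderiv_Suc_pCons) (simp only: poly_add poly_pCons poly_smult, simp)

text \<open>Each differentiation leaves all but one of the factors \<open>[:- a, 1:]\<close>, so
  \<open>k\<close> of them leave at least one.\<close>

lemma poly_higher_pderiv_eq_0:
  fixes F :: "'a::{idom,semiring_char_0} poly"
  assumes "[:- a, 1:] ^ e dvd F" and "k < e"
  shows "poly ((pderiv ^^ k) F) a = 0"
  using assms
proof (induction k arbitrary: e F)
  case 0
  then have "[:- a, 1:] dvd F"
    by (metis dvd_power dvd_trans)
  then show ?case
    by (simp add: poly_eq_0_iff_dvd)
next
  case (Suc k)
  then obtain m where m: "e = Suc m" "k < m"
    by (cases e) auto
  from Suc.prems(1) obtain G where "F = [:- a, 1:] ^ Suc m * G"
    unfolding m by (elim dvdE)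
  then have "pderiv F =
      [:- a, 1:] ^ m * ([:- a, 1:] * pderiv G + smult (of_nat (Suc m)) G)"
    by (simp add: pderiv_mult pderiv_power_Suc pderiv_pCons algebra_simps
             del: power_Suc of_nat_Suc)
       (simp add: algebra_simps)
  then have "[:- a, 1:] ^ m dvd pderiv F"
    by simp
  from Suc.IH[OF this m(2)] show ?case
    by (simp add: funpow_Suc_right del: funpow.simps)
qed

section \<open>Derivative bounds inside and outside the unit circle\<close>

text \<open>Induction over \<open>pCons\<close> is Horner's scheme itself. With
  \<open>c = 1 - cmod a\<close>, the term from the lower derivative (or from \<open>b\<close>, if
  \<open>k = 0\<close>) contributes \<open>c\<close> times the claimed bound and the other term
  \<open>1 - c\<close> times.\<close>

lemma norm_higher_pderiv_le_inside:
  fixes F :: "complex poly"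
  assumes "0 \<le> B" and "\<And>i. cmod (coeff F i) \<le> B" and a: "cmod a < 1"
  shows "cmod (poly ((pderiv ^^ k) F) a) \<le> fact k * B / \<bar>cmod a - 1\<bar> ^ (k + 1)"
  using assms(2)
proof (induction F arbitrary: k)
  case 0
  then show ?case using \<open>0 \<le> B\<close> by simp
next
  case (pCons b p)
  define c where "c = 1 - cmod a"
  have c: "c > 0" "\<bar>cmod a - 1\<bar> = c" "cmod a = 1 - c"
    using a by (auto simp: c_def)
  have "cmod b \<le> B" and "cmod (coeff p i) \<le> B" for i
    using pCons.prems[of 0] pCons.prems[of "Suc i"] by auto
  with pCons.IH have IH: "cmod (poly ((pderiv ^^ k) p) a) \<le> fact k * B / c ^ (k + 1)" for k
    unfolding c(2) by blast
  show ?case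
  proof (cases k)
    case 0
    have "cmod (poly (pCons b p) a) \<le> cmod b + cmod a * cmod (poly p a)"
      by (simp add: norm_triangle_le flip: norm_mult)
    also have "\<dots> \<le> B + cmod a * (B / c)"
      using IH[of 0] \<open>cmod b \<le> B\<close> by (intro add_mono mult_left_mono) auto
    also have "\<dots> = B / c"
      unfolding c(3) using c(1) by (simp add: field_simps)
    finally show ?thesis
      using 0 c by simp
  next
    case (Suc l)
    have "cmod (poly ((pderiv ^^ Suc l) (pCons b p)) a) \<le>
        cmod a * cmod (poly ((pderiv ^^ Suc l) p) a) + Suc l * cmod (poly ((pderiv ^^ l) p) a)"
      unfolding poly_higher_pderiv_Suc_pCons
      by (rule order_trans[OF norm_triangle_ineq]) (simp only: norm_mult norm_of_nat order_refl)
    also have "\<dots> \<le> cmod a * (fact (Suc l) * B / c ^ (Suc l + 1))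
        + Suc l * (fact l * B / c ^ (l + 1))"
      by (intro add_mono mult_left_mono IH) auto
    also have "\<dots> = fact (Suc l) * B / c ^ (Suc l + 1)"
      unfolding c(3) using c(1) by (simp add: field_simps)
    finally show ?thesis
      unfolding Suc c(2) .
  qed
qed

lemma poly_shift_eq_pCons: "poly_shift i p = pCons (coeff p i) (poly_shift (Suc i) p)"
  by (rule poly_eqI) (auto simp: coeff_poly_shift coeff_pCons split: nat.split)

text \<open>Solving the recursion for the next shift divides by \<open>cmod a = 1 + c\<close>, and
  the two terms on the other side add up to \<open>1 + c\<close> times the claimed bound.\<close>

lemma norm_higher_pderiv_poly_shift_le_outside:
  fixes F :: "complex poly"
  assumes "0 \<le> B" and coeff: "\<And>i. cmod (coeff F i) \<le> B" and a: "1 < cmod a"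
    and zero: "\<And>k. k < e \<Longrightarrow> poly ((pderiv ^^ k) F) a = 0"
    and "k < e"
  shows "cmod (poly ((pderiv ^^ k) (poly_shift i F)) a) \<le> fact k * B / \<bar>cmod a - 1\<bar> ^ (k + 1)"
  using \<open>k < e\<close>
proof (induction i arbitrary: k)
  case 0
  then show ?case using zero \<open>0 \<le> B\<close> by simp
next
  case (Suc i)
  define c where "c = cmod a - 1"
  define p where "p = poly_shift (Suc i) F"
  define q where "q = poly_shift i F"
  have q: "q = pCons (coeff F i) p"
    unfolding p_def q_def by (rule poly_shift_eq_pCons)
  have c: "c > 0" "\<bar>cmod a - 1\<bar> = c" "cmod a = 1 + c"
    using a by (auto simp: c_def)
  have IH: "cmod (poly ((pderiv ^^ k) q) a) \<le> fact k * B / c ^ (k + 1)" if "k < e" for k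
    using Suc.IH[OF that] unfolding c(2) q_def .
  \<comment> \<open>An inner induction on the order is needed: the \<open>k\<close>-th derivative of
    \<open>p\<close> depends on that of \<open>q\<close>, bounded by \<open>IH\<close>, and on the
    preceding derivative of \<open>p\<close> itself.\<close>
  have "cmod (poly ((pderiv ^^ k) p) a) \<le> fact k * B / c ^ (k + 1)"
    using Suc.prems
  proof (induction k)
    case 0
    have "cmod a * cmod (poly p a) = cmod (poly q a - coeff F i)"
      by (simp add: q norm_mult)
    also have "\<dots> \<le> cmod (poly q a) + cmod (coeff F i)"
      by (rule norm_triangle_ineq4)
    also have "\<dots> \<le> B / c + B"
      using IH[of 0] 0 coeff[of i] by (intro add_mono) auto
    also have "\<dots> = cmod a * (B / c)"
      using c by (simp add: field_simps)
    finally have "cmod (poly p a) \<le> B / c"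
      using a by (subst (asm) mult_le_cancel_left_pos) auto
    then show ?case
      by simp
  next
    case (Suc l)
    have "cmod a * cmod (poly ((pderiv ^^ Suc l) p) a) =
        cmod (poly ((pderiv ^^ Suc l) q) a - of_nat (Suc l) * poly ((pderiv ^^ l) p) a)"
      unfolding q poly_higher_pderiv_Suc_pCons by (simp only: add_diff_cancel_right' norm_mult)
    also have "\<dots> \<le>
        cmod (poly ((pderiv ^^ Suc l) q) a) + Suc l * cmod (poly ((pderiv ^^ l) p) a)"
      by (rule order_trans[OF norm_triangle_ineq4]) (simp only: norm_mult norm_of_nat order_refl)
    also have "\<dots> \<le> fact (Suc l) * B / c ^ (Suc l + 1) + Suc l * (fact l * B / c ^ (l + 1))"
      using Suc by (intro add_mono mult_left_mono IH) auto
    also have "\<dots> = cmod a * (fact (Suc l) * B / c ^ (Suc l + 1))"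
      unfolding c(3) using c(1) by (simp add: field_simps)
    finally show ?case
      using a by (subst (asm) mult_le_cancel_left_pos) auto
  qed
  then show ?case
    unfolding c(2) p_def .
qed

section \<open>Passage to complex coefficients and congruence modulo \<open>P\<close>\<close>

lemma map_poly_of_int_add:
  "map_poly of_int (p + q) = (map_poly of_int p + map_poly of_int q :: 'a::ring_1 poly)"
  by (rule poly_eqI) (simp add: coeff_map_poly)

lemma map_poly_of_int_mult:
  "map_poly of_int (p * q) = (map_poly of_int p * map_poly of_int q :: 'a::comm_ring_1 poly)"
  by (rule poly_eqI) (simp add: coeff_map_poly coeff_mult)

lemma map_poly_of_int_poly_shift:
  "map_poly of_int (poly_shift i p) = (poly_shift i (map_poly of_int p) :: 'a::ring_1 poly)"
  by (rule poly_eqI) (simp add: coeff_map_poly coeff_poly_shift)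

lemma dvd_diff_pseudo_mod:
  fixes P :: "int poly"
  assumes "lead_coeff P = 1"
  shows "P dvd F - pseudo_mod F P"
proof -
  obtain Q where "F = P * Q + pseudo_mod F P"
    using pseudo_mod_monic_iff[OF assms, of F "pseudo_mod F P"] by blast
  then have "F - pseudo_mod F P = P * Q"
    by (metis add_diff_cancel_right')
  then show ?thesis
    by simp
qed

lemma cong_poly_iff_dvd:
  assumes "lead_coeff P = 1"
  shows "cong_poly P A C \<longleftrightarrow> P dvd A - C"
proof
  have dvd: "P dvd F - pseudo_mod F P" for F
    using assms by (rule dvd_diff_pseudo_mod)
  {
    assume "cong_poly P A C"
    then show "P dvd A - C"
      using dvd_diff[OF dvd[of A] dvd[of C]] by (simp add: cong_poly_def)
  next
    assume "P dvd A - C"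
    then have "P dvd (A - C) + (C - pseudo_mod C P)"
      using dvd by (intro dvd_add)
    then have "\<exists>Q. A = P * Q + pseudo_mod C P"
      by (simp add: dvd_def algebra_simps)
    then show "cong_poly P A C"
      using pseudo_mod_monic_iff[OF assms, of C "pseudo_mod C P"]
        pseudo_mod_monic_iff[OF assms, of A "pseudo_mod C P"]
      by (auto simp: cong_poly_def)
  }
qed

section \<open>Walks as Horner evaluations modulo \<open>P\<close>\<close>

lemma verts_rem_graph: "verts (rem_graph P s \<alpha> e D) = rem_verts P s \<alpha> e D"
  by (simp add: rem_graph_def)

lemma wf_digraph_rem_graph: "wf_digraph (rem_graph P s \<alpha> e D)"
  by unfold_locales (auto simp: rem_graph_def)

lemma awalk_rem_graph_Cons:
  assumes "lead_coeff P = 1"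
  shows "pre_digraph.awalk (rem_graph P s \<alpha> e D) u (x # p) w \<longleftrightarrow>
    u \<in> rem_verts P s \<alpha> e D \<and> x = (u, snd x) \<and>
    (\<exists>b\<in>D. P dvd snd x - pCons b u) \<and> pre_digraph.awalk (rem_graph P s \<alpha> e D) (snd x) p w"
proof -
  interpret wf_digraph "rem_graph P s \<alpha> e D"
    by (rule wf_digraph_rem_graph)
  show ?thesis
    unfolding awalk_Cons_iff
    using awalk_hd_in_verts[of "snd x" p w]
    by (cases x) (auto simp: rem_graph_def cong_poly_iff_dvd[OF assms])
qed

text \<open>Unrolling the congruences along the walk multiplies the start by \<open>X\<close> once
  per edge; \<open>C\<close> collects the digits that label the edges.\<close>

lemma poly_of_awalk_rem_graph:
  assumes P: "lead_coeff P = 1"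
    and "pre_digraph.awalk (rem_graph P s \<alpha> e D) u p 0"
  shows "\<exists>C. (\<forall>i<length p. coeff C i \<in> D) \<and> (\<forall>i\<ge>length p. coeff C i = 0) \<and>
    P dvd monom 1 (length p) * u + C"
  using assms(2)
proof (induction p arbitrary: u)
  case Nil
  then have "u = 0"
    by (simp add: pre_digraph.awalk_def pre_digraph.cas.simps)
  then show ?case
    by (intro exI[of _ 0]) simp
next
  case (Cons x p)
  obtain b where b: "b \<in> D" "P dvd snd x - pCons b u"
    and walk: "pre_digraph.awalk (rem_graph P s \<alpha> e D) (snd x) p 0"
    using Cons.prems unfolding awalk_rem_graph_Cons[OF P] by blast
  from Cons.IH[OF walk] obtain C where C: "\<forall>i<length p. coeff C i \<in> D"
    "\<forall>i\<ge>length p. coeff C i = 0" "P dvd monom 1 (length p) * snd x + C"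
    by blast
  let ?m = "length p"
  \<comment> \<open>Subtracting a multiple of the first edge's congruence eliminates the
    intermediate vertex \<open>snd x\<close>.\<close>
  have "P dvd (monom 1 ?m * snd x + C) - monom 1 ?m * (snd x - pCons b u)"
    using C(3) b(2) by (rule dvd_diff[OF _ dvd_mult])
  also have "\<dots> = monom 1 ?m * pCons b u + C"
    by (simp add: algebra_simps)
  also have "pCons b u = [:b:] + monom 1 1 * u"
    by (simp add: monom_altdef)
  also have "monom 1 ?m * ([:b:] + monom 1 1 * u) + C
      = monom 1 (Suc ?m) * u + (C + monom b ?m)"
    by (simp add: algebra_simps mult_monom flip: mult.assoc monom_0)
  finally show ?case
    \<comment> \<open>The first edge supplies the highest digit: \<open>b\<close> is still
      multiplied by \<open>X\<close> along the \<open>?m\<close> remaining edges.\<close>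
    using C b(1) by (intro exI[of _ "C + monom b ?m"]) (auto simp: less_Suc_eq)
qed

lemma awalk_rem_graph_of_shifts:
  assumes P: "lead_coeff P = 1"
    and "\<And>i. i < n \<Longrightarrow> coeff Q i \<in> D"
    and "\<And>i. i \<le> n \<Longrightarrow> pseudo_mod (poly_shift i Q) P \<in> rem_verts P s \<alpha> e D"
  shows "\<exists>p. pre_digraph.awalk (rem_graph P s \<alpha> e D)
    (pseudo_mod (poly_shift n Q) P) p (pseudo_mod Q P) \<and> length p = n"
  using assms(2,3)
proof (induction n)
  case 0
  from "0.prems"(2)[of 0] show ?case
    by (simp add: pre_digraph.awalk_def pre_digraph.cas.simps verts_rem_graph)
next
  case (Suc n)
  let ?R = "\<lambda>i. pseudo_mod (poly_shift i Q) P"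
  from Suc obtain p where
    p: "pre_digraph.awalk (rem_graph P s \<alpha> e D) (?R n) p (pseudo_mod Q P)" "length p = n"
    by force
  have mod: "P dvd F - pseudo_mod F P" for F
    using P by (rule dvd_diff_pseudo_mod)
  \<comment> \<open>The exact identity
    \<open>poly_shift n Q = X * poly_shift (Suc n) Q + coeff Q n\<close> turns into the congruence
    of an edge once both shifts are replaced by their remainders.\<close>
  have "P dvd [:0, 1:] * (poly_shift (Suc n) Q - ?R (Suc n)) - (poly_shift n Q - ?R n)"
    by (rule dvd_diff[OF dvd_mult mod]) (rule mod)
  also have "\<dots> = ?R n - pCons (coeff Q n) (?R (Suc n))"
    by (subst poly_shift_eq_pCons[of n]) (rule poly_eqI, simp add: coeff_pCons split: nat.split)
  finally have "pre_digraph.awalk (rem_graph P s \<alpha> e D) (?R (Suc n))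
      ((?R (Suc n), ?R n) # p) (pseudo_mod Q P)"
    unfolding awalk_rem_graph_Cons[OF P] using p(1) Suc.prems by auto
  then show ?case
    using p(2) by (intro exI[of _ "(?R (Suc n), ?R n) # p"]) simp
qed

text \<open>Multiples of \<open>P\<close> have vanishing derivatives of order below
  \<open>e j\<close> at \<open>\<alpha> j\<close>, so the remainder inherits the derivative values
  of the shift there.\<close>

lemma pseudo_mod_poly_shift_in_Rem:
  assumes P: "lead_coeff P = 1"
    and circle: "\<And>z. poly (map_poly complex_of_int P) z = 0 \<Longrightarrow> cmod z \<noteq> 1"
    and fact: "map_poly complex_of_int P = (\<Prod>j=1..s. [:- \<alpha> j, 1:] ^ e j)"
    and B: "0 \<le> B" "\<And>i. \<bar>coeff Q i\<bar> \<le> B"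
    and "P dvd Q"
  shows "pseudo_mod (poly_shift i Q) P \<in> Rem P s \<alpha> e B"
proof -
  let ?c = "map_poly complex_of_int" and ?S = "poly_shift i Q"
  define R where "R = pseudo_mod ?S P"
  obtain q where q: "?S = P * q + R" and deg: "R = 0 \<or> degree R < degree P"
    using pseudo_mod_monic_iff[OF P, of ?S R] by (auto simp: R_def)
  have "cmod (poly ((pderiv ^^ k) (?c R)) (\<alpha> j)) \<le> fact k * real_of_int B / \<bar>cmod (\<alpha> j) - 1\<bar> ^ (k + 1)"
    if j: "j \<in> {1..s}" and k: "k < e j" for j k
  proof -
    have dvd: "[:- \<alpha> j, 1:] ^ e j dvd ?c (P * F)" for F
      unfolding map_poly_of_int_mult fact using j by (intro dvd_mult2 dvd_prodI) auto
    have zero: "poly ((pderiv ^^ l) (?c (P * F))) (\<alpha> j) = 0" if "l < e j" for l F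
      using poly_higher_pderiv_eq_0[OF dvd that] .
    have "poly (?c P) (\<alpha> j) = 0"
      using zero[of 0 1] k by simp
    then have "cmod (\<alpha> j) \<noteq> 1"
      by (rule circle)
    have coeff: "cmod (coeff (?c Q) i) \<le> real_of_int B" for i
      using B(2)[of i] by (simp add: coeff_map_poly flip: of_int_abs)
    have "(pderiv ^^ k) (?c ?S) = (pderiv ^^ k) (?c (P * q)) + (pderiv ^^ k) (?c R)"
      unfolding q map_poly_of_int_add higher_pderiv_add ..
    then have eq: "poly ((pderiv ^^ k) (?c R)) (\<alpha> j) = poly ((pderiv ^^ k) (poly_shift i (?c Q))) (\<alpha> j)"
      using zero[OF k] by (simp add: map_poly_of_int_poly_shift)
    show ?thesis
    proof (cases "cmod (\<alpha> j) < 1")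
      case True
      with B(1) coeff show ?thesis
        unfolding eq by (intro norm_higher_pderiv_le_inside) (auto simp: coeff_poly_shift)
    next
      \<comment> \<open>Outside the circle the induction starts from \<open>Q\<close> itself, a
        multiple of \<open>P\<close>, whose derivatives are covered by \<open>zero\<close>.\<close>
      case False
      from \<open>P dvd Q\<close> obtain F where "Q = P * F" ..
      with False \<open>cmod (\<alpha> j) \<noteq> 1\<close> B(1) coeff zero k show ?thesis
        unfolding eq by (intro norm_higher_pderiv_poly_shift_le_outside[of _ _ _ "e j"]) auto
    qed
  qed
  with deg show ?thesis
    unfolding Rem_def R_def by blast
qed

theorem theorem4p5:
  fixes D :: "int set" and P :: "int poly"
    and s :: nat and \<alpha> :: "nat \<Rightarrow> complex" and e :: "nat \<Rightarrow> nat"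
    and n :: nat and an :: int
  assumes "finite D"
    and "lead_coeff P = 1"
    and "\<And>z. poly (map_poly complex_of_int P) z = 0 \<Longrightarrow> cmod z \<noteq> 1"
    and "s \<ge> 1"
    and "inj_on \<alpha> {1..s}"
    and "\<And>j. j \<in> {1..s} \<Longrightarrow> e j \<ge> 1"
    and "map_poly complex_of_int P = (\<Prod>j=1..s. [:- \<alpha> j, 1:] ^ e j)"
    and "an \<in> D" and "an \<noteq> 0"
  shows "(\<exists>Q :: int poly. degree Q = n \<and> coeff Q n = an \<and> (\<forall>i\<le>n. coeff Q i \<in> D) \<and> P dvd Q)
     \<longleftrightarrow> (\<exists>p. pre_digraph.awalk (rem_graph P s \<alpha> e D) [:an:] p 0 \<and> length p = n)"
proof
  assume "\<exists>Q :: int poly. degree Q = n \<and> coeff Q n = an \<and> (\<forall>i\<le>n. coeff Q i \<in> D) \<and> P dvd Q"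
  then obtain Q where Q: "degree Q = n" "coeff Q n = an" "\<And>i. i \<le> n \<Longrightarrow> coeff Q i \<in> D" "P dvd Q"
    by blast
  \<comment> \<open>\<open>P\<close> has the root \<open>\<alpha> 1\<close>. Being nonconstant, it
    leaves the constant \<open>[:an:]\<close> unreduced, so the walk really starts there.\<close>
  have "0 < degree P"
  proof (rule ccontr)
    assume "\<not> 0 < degree P"
    with \<open>lead_coeff P = 1\<close> have "map_poly complex_of_int P = 1"
      by (auto elim!: degree_eq_zeroE simp: one_pCons map_poly_pCons)
    moreover have "poly (map_poly complex_of_int P) (\<alpha> 1) = 0"
      using assms(4) assms(6)[of 1] by (auto simp: assms(7) poly_prod intro!: prod_zero bexI[of _ 1])
    ultimately show False
      by simp
  qed
  have shift_n: "poly_shift n Q = [:an:]"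
    using Q(1,2) by (intro poly_eqI) (auto simp: coeff_poly_shift coeff_pCons coeff_eq_0 split: nat.split)
  have mod_n: "pseudo_mod [:an:] P = [:an:]"
    using \<open>0 < degree P\<close> by (subst pseudo_mod_monic_iff[OF assms(2)]) (auto intro: exI[of _ 0])
  have mod_0: "pseudo_mod Q P = 0"
    using Q(4) by (subst pseudo_mod_monic_iff[OF assms(2)]) (auto elim: dvdE)
  have Max: "\<bar>d\<bar> \<le> Max (abs ` D)" if "d \<in> D" for d
    using that \<open>finite D\<close> by simp
  then have Max_nonneg: "0 \<le> Max (abs ` D)"
    using \<open>an \<in> D\<close> abs_ge_zero order_trans by blast
  have "\<bar>coeff Q i\<bar> \<le> Max (abs ` D)" for i
    using Max Max_nonneg Q(1,3) by (cases "i \<le> n") (auto simp: coeff_eq_0)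
  then have "pseudo_mod (poly_shift i Q) P \<in> rem_verts P s \<alpha> e D" for i
    unfolding rem_verts_def
    using pseudo_mod_poly_shift_in_Rem[OF assms(2,3,7) Max_nonneg _ Q(4)] by blast
  with Q(3) have "\<exists>p. pre_digraph.awalk (rem_graph P s \<alpha> e D)
      (pseudo_mod (poly_shift n Q) P) p (pseudo_mod Q P) \<and> length p = n"
    by (intro awalk_rem_graph_of_shifts[OF assms(2)]) auto
  then show "\<exists>p. pre_digraph.awalk (rem_graph P s \<alpha> e D) [:an:] p 0 \<and> length p = n"
    unfolding shift_n mod_n mod_0 .
next
  assume "\<exists>p. pre_digraph.awalk (rem_graph P s \<alpha> e D) [:an:] p 0 \<and> length p = n"
  then obtain C where C: "\<forall>i<n. coeff C i \<in> D" "\<forall>i\<ge>n. coeff C i = 0" "P dvd monom 1 n * [:an:] + C"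
    using poly_of_awalk_rem_graph[OF assms(2)] by blast
  \<comment> \<open>The leading coefficient comes from the start vertex; the \<open>n\<close> edges
    provide only the coefficients below it.\<close>
  define Q where "Q = monom an n + C"
  have coeff: "coeff Q i = (if i = n then an else coeff C i)" for i
    using C(2) by (auto simp: Q_def)
  have "degree Q = n"
    using C(2) \<open>an \<noteq> 0\<close> by (intro antisym degree_le le_degree) (auto simp: coeff)
  moreover have "P dvd Q"
    using C(3) by (simp add: Q_def mult_monom flip: monom_0)
  ultimately show "\<exists>Q :: int poly. degree Q = n \<and> coeff Q n = an \<and> (\<forall>i\<le>n. coeff Q i \<in> D) \<and> P dvd Q"
    using C(1) \<open>an \<in> D\<close> by (intro exI[of _ Q]) (auto simp: coeff)
qed

end
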